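(* Let $\|\cdot\|$ be a smooth and strictly convex norm on $\mathbb{R}^3$. A surface immersion $f:M\rightarrow(\mathbb{R}^3,\|\cdot\|)$ endowed with the Birkhoff normal vector field $\eta$ is an equiaffine immersion.
   Context: Let $B$ and $\partial B$ be the unit ball and unit sphere of $\|\cdot\|$. Smooth means that $\partial B$ is locally the graph of a $C^\infty$ function; strictly convex means that $\partial B$ contains no line segment. A non-zero vector $v$ is Birkhoff orthogonal to a 2-dimensional subspace $H$ ($v\dashv_B H$) if the plane through $v/\|v\|$ parallel to $H$ supports $B$. $M$ is identified with its image and $T_pM$ with the plane $df_p(T_pM)\subset\mathbb{R}^3$. The Birkhoff normal vector field of $M$ is a (locally defined) smooth map $\eta$ into $\partial B$ with $\eta(p)\dashv_B T_pM$; it is transversal to $M$. Let $D$ be the standard flat connection of $\mathbb{R}^3$. For a surface immersion with a smooth transversal vector field $\xi$ one decomposes, for tangent vectors $X$, $D_X\xi=-f_*(SX)+\tau(X)\xi$, with $S$ a linear endomorphism of the tangent space and $\tau$ a 1-form. The immersion together with $\xi$ is called equiaffine if $\tau=0$ identically, i.e. $D_X\xi$ is tangent to $M$ for every tangent $X$. *)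

theory Defs
  imports "HOL-Analysis.Analysis"
begin

text \<open>
  \<open>C\<^sup>k\<close> and \<open>C\<^sup>\<infinity>\<close> maps between Euclidean spaces. The predicates are meant for open \<open>U\<close>;
  differentiability is taken in a full neighbourhood of each point, and the derivatives of the
  next order are the directional derivatives in every direction \<open>v\<close>.
\<close>

fun Ck_on :: "nat \<Rightarrow> 'a::euclidean_space set \<Rightarrow> ('a \<Rightarrow> 'b::euclidean_space) \<Rightarrow> bool" where
  "Ck_on 0 U g \<longleftrightarrow> continuous_on U g"
| "Ck_on (Suc k) U g \<longleftrightarrow>
     (\<forall>x\<in>U. g differentiable (at x)) \<and>
     (\<forall>v. Ck_on k U (\<lambda>x. frechet_derivative g (at x) v))"

definition smooth_on :: "'a::euclidean_space set \<Rightarrow> ('a \<Rightarrow> 'b::euclidean_space) \<Rightarrow> bool" where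
  "smooth_on U g \<longleftrightarrow> (\<forall>k. Ck_on k U g)"

text \<open>
  The norm under study is an explicit function \<open>N\<close>, since the type \<^typ>\<open>real^3\<close> already carries
  the Euclidean norm. The Euclidean structure serves only for the topology,
  for derivatives, and to write planes and half-spaces as \<open>a \<bullet> x = b\<close> and \<open>a \<bullet> x \<le> b\<close>.
\<close>

definition is_norm :: "(real^3 \<Rightarrow> real) \<Rightarrow> bool" where
  "is_norm N \<longleftrightarrow>
     (\<forall>x. 0 \<le> N x) \<and> (\<forall>x. N x = 0 \<longleftrightarrow> x = 0) \<and>
     (\<forall>a x. N (a *\<^sub>R x) = \<bar>a\<bar> * N x) \<and> (\<forall>x y. N (x + y) \<le> N x + N y)"

definition unit_ball :: "(real^3 \<Rightarrow> real) \<Rightarrow> (real^3) set" where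
  "unit_ball N = {x. N x \<le> 1}"

definition unit_sphere :: "(real^3 \<Rightarrow> real) \<Rightarrow> (real^3) set" where
  "unit_sphere N = {x. N x = 1}"

text \<open>
  Locally a graph: near each point, and in suitable linear coordinates \<open>L\<close> on three-space,
  the unit sphere is the set of all \<open>(u, h u)\<close> with \<open>u\<close> in an open set of the plane.
\<close>

definition smooth_norm :: "(real^3 \<Rightarrow> real) \<Rightarrow> bool" where
  "smooth_norm N \<longleftrightarrow>
     (\<forall>x\<in>unit_sphere N. \<exists>G (L :: (real^2) \<times> real \<Rightarrow> real^3) V (h :: real^2 \<Rightarrow> real).
        open G \<and> x \<in> G \<and> linear L \<and> bij L \<and> open V \<and> smooth_on V h \<and>
        unit_sphere N \<inter> G = L ` ((\<lambda>u. (u, h u)) ` V))"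

definition strictly_convex_norm :: "(real^3 \<Rightarrow> real) \<Rightarrow> bool" where
  "strictly_convex_norm N \<longleftrightarrow>
     (\<forall>a b. a \<noteq> b \<longrightarrow> \<not> closed_segment a b \<subseteq> unit_sphere N)"

definition plane_supports :: "(real^3) set \<Rightarrow> (real^3) set \<Rightarrow> bool" where
  "plane_supports P K \<longleftrightarrow>
     P \<inter> K \<noteq> {} \<and> (\<exists>a b. a \<noteq> 0 \<and> P = {x. a \<bullet> x = b} \<and> K \<subseteq> {x. a \<bullet> x \<le> b})"

definition birkhoff_orthogonal :: "(real^3 \<Rightarrow> real) \<Rightarrow> real^3 \<Rightarrow> (real^3) set \<Rightarrow> bool" where
  "birkhoff_orthogonal N v H \<longleftrightarrow>
     v \<noteq> 0 \<and> subspace H \<and> dim H = 2 \<and>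
     plane_supports ((\<lambda>w. v /\<^sub>R N v + w) ` H) (unit_ball N)"

text \<open>
  A chart is a pair of its domain and its coordinate map; only the values of the coordinate map
  on the domain matter.
\<close>

type_synonym 'm chart = "'m set \<times> ('m \<Rightarrow> real^2)"

definition chart_inv :: "'m chart \<Rightarrow> real^2 \<Rightarrow> 'm" where
  "chart_inv c = inv_into (fst c) (snd c)"

definition smooth_surface :: "'m topology \<Rightarrow> 'm chart set \<Rightarrow> bool" where
  "smooth_surface M A \<longleftrightarrow>
     Hausdorff_space M \<and> second_countable M \<and>
     (\<Union>c\<in>A. fst c) = topspace M \<and>
     (\<forall>c\<in>A. openin M (fst c) \<and> open (snd c ` fst c) \<and>
        homeomorphic_map (subtopology M (fst c)) (top_of_set (snd c ` fst c)) (snd c)) \<and>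
     (\<forall>c\<in>A. \<forall>d\<in>A. smooth_on (snd c ` (fst c \<inter> fst d)) (snd d \<circ> chart_inv c))"

definition smooth_map_on :: "'m chart set \<Rightarrow> 'm set \<Rightarrow> ('m \<Rightarrow> real^3) \<Rightarrow> bool" where
  "smooth_map_on A W g \<longleftrightarrow>
     (\<forall>c\<in>A. smooth_on (snd c ` (fst c \<inter> W)) (g \<circ> chart_inv c))"

text \<open>
  A chart \<open>c\<close> around \<open>p\<close> identifies the tangent space at \<open>p\<close> with \<^typ>\<open>real^2\<close>. Under this
  identification \<open>chart_diff c g p X\<close> is \<open>dg\<^sub>p(X)\<close>, that is, the flat derivative \<open>D\<^sub>X g\<close> of the
  vector-valued map \<open>g\<close>. Another chart around \<open>p\<close> changes \<open>X\<close> by an isomorphism of \<^typ>\<open>real^2\<close>,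
  so quantifying over all charts around \<open>p\<close> in the notions below is the same as choosing one.
\<close>

definition chart_diff :: "'m chart \<Rightarrow> ('m \<Rightarrow> real^3) \<Rightarrow> 'm \<Rightarrow> real^2 \<Rightarrow> real^3" where
  "chart_diff c g p = frechet_derivative (g \<circ> chart_inv c) (at (snd c p))"

definition tangent_plane :: "'m chart \<Rightarrow> ('m \<Rightarrow> real^3) \<Rightarrow> 'm \<Rightarrow> (real^3) set" where
  "tangent_plane c f p = range (chart_diff c f p)"

definition surface_immersion :: "'m topology \<Rightarrow> 'm chart set \<Rightarrow> ('m \<Rightarrow> real^3) \<Rightarrow> bool" where
  "surface_immersion M A f \<longleftrightarrow>
     smooth_surface M A \<and> smooth_map_on A (topspace M) f \<and>
     (\<forall>c\<in>A. \<forall>p\<in>fst c. inj (chart_diff c f p))"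

text \<open>Vector fields along the immersion are local: they are considered on an open \<open>W\<close> only.\<close>

definition transversal_field ::
  "'m chart set \<Rightarrow> ('m \<Rightarrow> real^3) \<Rightarrow> 'm set \<Rightarrow> ('m \<Rightarrow> real^3) \<Rightarrow> bool" where
  "transversal_field A f W \<xi> \<longleftrightarrow>
     smooth_map_on A W \<xi> \<and>
     (\<forall>c\<in>A. \<forall>p\<in>fst c \<inter> W. \<xi> p \<notin> tangent_plane c f p)"

text \<open>The decomposition \<open>D\<^sub>X \<xi> = -f\<^sub>*(S X) + \<tau>(X) \<xi>\<close> at the point \<open>p\<close>.\<close>

definition weingarten_decomposition ::
  "'m chart \<Rightarrow> ('m \<Rightarrow> real^3) \<Rightarrow> ('m \<Rightarrow> real^3) \<Rightarrow> 'm \<Rightarrow>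
   (real^2 \<Rightarrow> real^2) \<Rightarrow> (real^2 \<Rightarrow> real) \<Rightarrow> bool" where
  "weingarten_decomposition c f \<xi> p S \<tau> \<longleftrightarrow>
     linear S \<and> linear \<tau> \<and>
     (\<forall>X. chart_diff c \<xi> p X = - chart_diff c f p (S X) + \<tau> X *\<^sub>R \<xi> p)"

text \<open>
  For an immersion and a transversal field the pair \<open>(S, \<tau>)\<close> exists and is unique, so vanishing of
  \<open>\<tau>\<close> is expressed by a decomposition whose second component is zero.
\<close>

definition equiaffine_immersion ::
  "'m topology \<Rightarrow> 'm chart set \<Rightarrow> ('m \<Rightarrow> real^3) \<Rightarrow> 'm set \<Rightarrow> ('m \<Rightarrow> real^3) \<Rightarrow> bool" where
  "equiaffine_immersion M A f W \<xi> \<longleftrightarrow>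
     surface_immersion M A f \<and> openin M W \<and> transversal_field A f W \<xi> \<and>
     (\<forall>c\<in>A. \<forall>p\<in>fst c \<inter> W. \<exists>S \<tau>. weingarten_decomposition c f \<xi> p S \<tau> \<and> (\<forall>X. \<tau> X = 0))"

definition birkhoff_normal_field ::
  "(real^3 \<Rightarrow> real) \<Rightarrow> 'm topology \<Rightarrow> 'm chart set \<Rightarrow> ('m \<Rightarrow> real^3) \<Rightarrow> 'm set \<Rightarrow>
   ('m \<Rightarrow> real^3) \<Rightarrow> bool" where
  "birkhoff_normal_field N M A f W \<eta> \<longleftrightarrow>
     openin M W \<and> smooth_map_on A W \<eta> \<and> \<eta> ` W \<subseteq> unit_sphere N \<and>
     (\<forall>c\<in>A. \<forall>p\<in>fst c \<inter> W. birkhoff_orthogonal N (\<eta> p) (tangent_plane c f p))"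

end

theory Submission
  imports Defs
begin

text \<open>
  Birkhoff orthogonality of \<open>\<eta> p\<close> to the tangent plane is an extremal property. With \<open>a\<close> the normal
  of the supporting plane through \<open>\<eta> p\<close>, the tangent plane is the kernel of \<open>x \<mapsto> a \<bullet> x\<close>, and this
  functional attains its maximum over the unit ball at \<open>\<eta> p\<close>. Since \<open>\<eta>\<close> takes values in the unit
  sphere, the function \<open>q \<mapsto> a \<bullet> \<eta> q\<close>, with \<open>a\<close> kept fixed, has a maximum at \<open>p\<close>; hence its
  derivative \<open>a \<bullet> D\<^sub>X \<eta>\<close> vanishes there, which says that \<open>D\<^sub>X \<eta>\<close> is tangent. Transversality holds
  because the maximum of a non-zero functional over the ball is positive, so \<open>a \<bullet> \<eta> p \<noteq> 0\<close>.
  The shape operator is then \<open>D\<^sub>X \<eta>\<close>, with the sign reversed, pulled back by the injective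
  differential of the immersion.
\<close>

text \<open>
  The affine support condition in linear form: the level of the supporting plane is the value at the
  unit vector \<open>v\<close> itself, so its direction \<open>H\<close> is the kernel of the supporting functional.
  It is positive because the functional is positive at \<open>a / N a\<close>, a point of the ball.
\<close>

lemma birkhoff_orthogonal_functional:
  assumes N: "is_norm N" and v: "N v = 1" and vH: "birkhoff_orthogonal N v H"
  obtains a where "H = {x. a \<bullet> x = 0}" and "0 < a \<bullet> v"
    and "\<And>x. N x \<le> 1 \<Longrightarrow> a \<bullet> x \<le> a \<bullet> v"
proof -
  have H: "subspace H" and supp: "plane_supports ((\<lambda>w. v + w) ` H) (unit_ball N)"
    using vH v by (auto simp: birkhoff_orthogonal_def)
  from supp obtain a b where a: "a \<noteq> 0" and plane: "(\<lambda>w. v + w) ` H = {x. a \<bullet> x = b}"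
    and ball: "unit_ball N \<subseteq> {x. a \<bullet> x \<le> b}"
    by (auto simp: plane_supports_def)
  have "v + 0 \<in> (\<lambda>w. v + w) ` H"
    using subspace_0[OF H] by blast
  then have b: "b = a \<bullet> v"
    using plane by auto
  have ker: "x \<in> H \<longleftrightarrow> a \<bullet> x = 0" for x
  proof -
    have "x \<in> H \<longleftrightarrow> v + x \<in> (\<lambda>w. v + w) ` H"
      by auto
    also have "\<dots> \<longleftrightarrow> a \<bullet> x = 0"
      unfolding plane by (simp add: b inner_add_right)
    finally show ?thesis .
  qed
  have max: "a \<bullet> x \<le> a \<bullet> v" if "N x \<le> 1" for x
    using ball that b by (auto simp: unit_ball_def)
  have Na: "0 < N a"
    using N a by (metis is_norm_def order_le_less)
  have "N (inverse (N a) *\<^sub>R a) = 1"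
    using N Na by (auto simp: is_norm_def)
  then have "a \<bullet> (inverse (N a) *\<^sub>R a) \<le> a \<bullet> v"
    by (intro max) simp
  moreover have "0 < a \<bullet> (inverse (N a) *\<^sub>R a)"
    using a Na by simp
  ultimately have "0 < a \<bullet> v"
    by linarith
  with ker max show ?thesis
    using that by blast
qed

lemma smooth_on_differentiable:
  assumes "smooth_on U g" and "x \<in> U"
  shows "g differentiable (at x)"
proof -
  have "Ck_on (Suc 0) U g"
    using assms(1) unfolding smooth_on_def by blast
  with assms(2) show ?thesis
    by simp
qed

lemma chart_inv_chart:
  assumes "smooth_surface M A" and "c \<in> A" and "p \<in> fst c"
  shows "chart_inv c (snd c p) = p"
proof -
  have o: "openin M (fst c)"
    and h: "homeomorphic_map (subtopology M (fst c)) (top_of_set (snd c ` fst c)) (snd c)"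
    using assms by (auto simp: smooth_surface_def)
  have "inj_on (snd c) (fst c)"
    using homeomorphic_imp_injective_map[OF h] openin_subset[OF o]
    by (simp add: topspace_subtopology Int_absorb1)
  with assms(3) show ?thesis
    by (simp add: chart_inv_def)
qed

lemma open_chart_image:
  assumes "smooth_surface M A" and "c \<in> A" and "openin M W"
  shows "open (snd c ` (fst c \<inter> W))"
proof -
  have op: "open (snd c ` fst c)"
    and h: "homeomorphic_map (subtopology M (fst c)) (top_of_set (snd c ` fst c)) (snd c)"
    using assms by (auto simp: smooth_surface_def)
  have "openin (subtopology M (fst c)) (fst c \<inter> W)"
    using assms(3) by (auto simp: openin_subtopology)
  then have "openin (top_of_set (snd c ` fst c)) (snd c ` (fst c \<inter> W))"
    using homeomorphic_imp_open_map[OF h] by (auto simp: open_map_def)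
  with op show ?thesis
    by (simp add: openin_open_eq)
qed

lemma chart_diff_has_derivative:
  assumes "smooth_map_on A W g" and "c \<in> A" and "p \<in> fst c \<inter> W"
  shows "((g \<circ> chart_inv c) has_derivative chart_diff c g p) (at (snd c p))"
proof -
  have "smooth_on (snd c ` (fst c \<inter> W)) (g \<circ> chart_inv c)"
    using assms(1,2) by (auto simp: smooth_map_on_def)
  then have "(g \<circ> chart_inv c) differentiable (at (snd c p))"
    by (rule smooth_on_differentiable) (use assms(3) in blast)
  then show ?thesis
    unfolding chart_diff_def by (simp add: frechet_derivative_works)
qed

text \<open>
  Fermat's criterion for a vector-valued map: a linear functional that is maximal over the values
  at \<open>p\<close> annihilates all derivatives at \<open>p\<close>. The chart image of \<open>W\<close> is open, so the maximum is
  interior there.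
\<close>

lemma inner_chart_diff_eq_0_at_max:
  assumes M: "smooth_surface M A" and W: "openin M W" and g: "smooth_map_on A W g"
    and c: "c \<in> A" and p: "p \<in> fst c \<inter> W"
    and max: "\<And>q. q \<in> fst c \<inter> W \<Longrightarrow> a \<bullet> g q \<le> a \<bullet> g p"
  shows "a \<bullet> chart_diff c g p X = 0"
proof -
  let ?U = "snd c ` (fst c \<inter> W)" and ?\<phi> = "\<lambda>y. a \<bullet> (g \<circ> chart_inv c) y"
  have D: "(?\<phi> has_derivative (\<lambda>X. a \<bullet> chart_diff c g p X)) (at (snd c p))"
    by (rule has_derivative_inner_right[OF chart_diff_has_derivative[OF g c p]])
  have U: "open ?U"
    by (rule open_chart_image[OF M c W])
  have xU: "snd c p \<in> ?U"
    using p by blast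
  have "?\<phi> y \<le> ?\<phi> (snd c p)" if "y \<in> ?U" for y
    using that p max chart_inv_chart[OF M c] by auto
  then have "(\<lambda>X. a \<bullet> chart_diff c g p X) = (\<lambda>X. 0)"
    using differential_zero_maxmin[OF xU U D] by blast
  then show ?thesis
    by meson
qed

theorem lemma4p1:
  fixes N :: "real^3 \<Rightarrow> real"
    and M :: "'m topology" and A :: "'m chart set"
    and f :: "'m \<Rightarrow> real^3"
    and W :: "'m set" and \<eta> :: "'m \<Rightarrow> real^3"
  assumes "is_norm N" and "smooth_norm N" and "strictly_convex_norm N"
    and "surface_immersion M A f"
    and "birkhoff_normal_field N M A f W \<eta>"
  shows "equiaffine_immersion M A f W \<eta>"
proof -
  have M: "smooth_surface M A" and f: "smooth_map_on A (topspace M) f"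
    and inj: "\<And>c p. c \<in> A \<Longrightarrow> p \<in> fst c \<Longrightarrow> inj (chart_diff c f p)"
    using assms(4) by (auto simp: surface_immersion_def)
  have W: "openin M W" and \<eta>: "smooth_map_on A W \<eta>"
    and sphere: "\<And>q. q \<in> W \<Longrightarrow> N (\<eta> q) = 1"
    and orth: "\<And>c p. c \<in> A \<Longrightarrow> p \<in> fst c \<inter> W \<Longrightarrow>
      birkhoff_orthogonal N (\<eta> p) (tangent_plane c f p)"
    using assms(5) by (auto simp: birkhoff_normal_field_def unit_sphere_def)
  have pointwise: "\<eta> p \<notin> tangent_plane c f p \<and>
      (\<exists>S \<tau>. weingarten_decomposition c f \<eta> p S \<tau> \<and> (\<forall>X. \<tau> X = 0))"
    if c: "c \<in> A" and p: "p \<in> fst c \<inter> W" for c p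
  proof -
    obtain a where T: "tangent_plane c f p = {x. a \<bullet> x = 0}" and pos: "0 < a \<bullet> \<eta> p"
      and max: "\<And>x. N x \<le> 1 \<Longrightarrow> a \<bullet> x \<le> a \<bullet> \<eta> p"
      using birkhoff_orthogonal_functional[OF assms(1) _ orth[OF c p]] sphere p by blast
    have transversal: "\<eta> p \<notin> tangent_plane c f p"
      using pos T by auto
    have "a \<bullet> chart_diff c \<eta> p X = 0" for X
      using inner_chart_diff_eq_0_at_max[OF M W \<eta> c p] max sphere by simp
    then have tangent: "chart_diff c \<eta> p X \<in> range (chart_diff c f p)" for X
      using T by (simp add: tangent_plane_def)
    have "p \<in> fst c \<inter> topspace M"
      using p openin_subset[OF W] by blast
    then have lin_f: "linear (chart_diff c f p)"
      using chart_diff_has_derivative[OF f c] has_derivative_linear by blast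
    have lin_\<eta>: "linear (chart_diff c \<eta> p)"
      using chart_diff_has_derivative[OF \<eta> c p] has_derivative_linear by blast
    obtain r where lin_r: "linear r" and r: "r \<circ> chart_diff c f p = id"
      using linear_injective_left_inverse[OF lin_f] inj c p by blast
    \<comment> \<open>Applied to \<open>D\<^sub>X \<eta>\<close>, which is tangent, the left inverse gives its coordinates.\<close>
    define S where "S X = - r (chart_diff c \<eta> p X)" for X
    have "linear S"
      using linear_compose_neg[OF linear_compose[OF lin_\<eta> lin_r]]
      by (simp add: S_def[abs_def] o_def)
    moreover have "chart_diff c \<eta> p X = - chart_diff c f p (S X)" for X
    proof -
      obtain Y where Y: "chart_diff c \<eta> p X = chart_diff c f p Y"
        using tangent by blast
      have "S X = - Y"
        using r Y by (simp add: S_def fun_eq_iff)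
      then show ?thesis
        using Y linear_neg[OF lin_f] by simp
    qed
    ultimately have "weingarten_decomposition c f \<eta> p S (\<lambda>X. 0)"
      by (simp add: weingarten_decomposition_def linear_zero)
    with transversal show ?thesis
      by blast
  qed
  show ?thesis
    unfolding equiaffine_immersion_def transversal_field_def
    using assms(4) W \<eta> pointwise by simp
qed

end
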